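(* There exists a universal integer $q>0$ such that for every $n\geq 1$, if $A$ is a closed set in $\mathbb{R}^n$ with $\gamma_n(A)\geq\frac23$, then there is an ellipsoid $E$ in $\mathbb{R}^n$ with $$\gamma_n(E)\geq\frac12\quad\text{and}\quad \sqrt{\frac{\log n}{n}}\,E\subset \underbrace{A+\cdots+A}_{q\text{ times}}.$$
   Context: $\gamma_n$ is the standard Gaussian measure on $\mathbb{R}^n$ and $A+\cdots+A$ is the Minkowski sum. An ellipsoid in $\mathbb{R}^n$ is any set of the form $\{x\in\mathbb{R}^n:\ x^TQx\leq 1\}$ where $Q$ is a symmetric positive semidefinite $n\times n$ matrix. *)

theory Defs
  imports "HOL-Probability.Probability" "HOL-Library.Function_Algebras" "HOL-Library.Set_Algebras"
begin

text \<open>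
  The dimension is quantified inside the theorem, so points are taken from
  \<^term>\<open>Euclidean_space n\<close>, i.e. they are functions \<^typ>\<open>nat \<Rightarrow> real\<close> with coordinates
  \<open>0, \<dots>, n - 1\<close> and value \<open>0\<close> elsewhere. Addition is pointwise
  (\<^theory>\<open>HOL-Library.Function_Algebras\<close>), hence sums of sets
  (\<^theory>\<open>HOL-Library.Set_Algebras\<close>) are Minkowski sums.
\<close>

text \<open>
  The product measure of \<open>n\<close> standard normal distributions lives on functions that are
  \<^const>\<open>undefined\<close> outside \<open>{..<n}\<close>; it is transported along the identification with
  zero-padded functions.
\<close>
definition std_gaussian :: "nat \<Rightarrow> (nat \<Rightarrow> real) measure" where
  "std_gaussian n =
     distr (Pi\<^sub>M {..<n} (\<lambda>_. std_normal_distribution))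
           (restrict_space borel (topspace (Euclidean_space n)))
           (\<lambda>x i. if i < n then x i else 0)"

text \<open>\<open>x\<^sup>T Q x\<close>; only the entries \<open>Q i j\<close> with \<open>i, j < n\<close> matter.\<close>
definition quad_form :: "nat \<Rightarrow> (nat \<Rightarrow> nat \<Rightarrow> real) \<Rightarrow> (nat \<Rightarrow> real) \<Rightarrow> real" where
  "quad_form n Q x = (\<Sum>i<n. \<Sum>j<n. x i * Q i j * x j)"

definition sym_psd :: "nat \<Rightarrow> (nat \<Rightarrow> nat \<Rightarrow> real) \<Rightarrow> bool" where
  "sym_psd n Q \<longleftrightarrow> (\<forall>i<n. \<forall>j<n. Q i j = Q j i)
     \<and> (\<forall>x \<in> topspace (Euclidean_space n). 0 \<le> quad_form n Q x)"

text \<open>As \<open>Q\<close> is only positive semidefinite, ellipsoids may be unbounded.\<close>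
definition ellipsoid :: "nat \<Rightarrow> (nat \<Rightarrow> real) set \<Rightarrow> bool" where
  "ellipsoid n E \<longleftrightarrow>
     (\<exists>Q. sym_psd n Q \<and> E = {x \<in> topspace (Euclidean_space n). quad_form n Q x \<le> 1})"

definition dilate :: "real \<Rightarrow> (nat \<Rightarrow> real) set \<Rightarrow> (nat \<Rightarrow> real) set" where
  "dilate c E = (\<lambda>x i. c * x i) ` E"

lemma pad_measurable:
  "(\<lambda>x i. if i < n then x i else 0) \<in>
     Pi\<^sub>M {..<n} (\<lambda>_. std_normal_distribution)
       \<rightarrow>\<^sub>M restrict_space borel (topspace (Euclidean_space n))"
proof (rule measurable_restrict_space2)
  show "(\<lambda>x i. if i < n then x i else (0::real)) \<in>
     Pi\<^sub>M {..<n} (\<lambda>_. std_normal_distribution) \<rightarrow>\<^sub>M borel"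
  proof (rule measurable_coordinatewise_then_product)
    fix i :: nat
    let ?M = "Pi\<^sub>M {..<n} (\<lambda>_. std_normal_distribution)"
    show "(\<lambda>x. if i < n then x i else (0::real)) \<in> ?M \<rightarrow>\<^sub>M borel"
    proof (cases "i < n")
      case True
      have "(\<lambda>x. x i) \<in> ?M \<rightarrow>\<^sub>M std_normal_distribution"
        using True by (intro measurable_component_singleton) auto
      then show ?thesis using True by simp
    qed simp
  qed
qed (auto simp: topspace_Euclidean_space)

lemma space_std_gaussian: "space (std_gaussian n) = topspace (Euclidean_space n)"
  by (simp add: std_gaussian_def space_restrict_space)

lemma prob_space_std_gaussian: "prob_space (std_gaussian n)"
  unfolding std_gaussian_def
  by (intro prob_space.prob_space_distr prob_space_PiM prob_space_normal_density pad_measurable) auto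

lemma closedin_sets_std_gaussian:
  assumes "closedin (Euclidean_space n) A"
  shows "A \<in> sets (std_gaussian n)"
proof -
  have "closed A" "A \<subseteq> topspace (Euclidean_space n)"
    using assms by (auto simp: closedin_Euclidean_space_iff)
  then show ?thesis
    by (auto simp: std_gaussian_def sets_restrict_space intro!: image_eqI[where x=A])
qed

lemma emeasure_std_gaussian_box:
  assumes "\<And>i. i < n \<Longrightarrow> B i \<in> sets borel"
  shows "emeasure (std_gaussian n) {x \<in> topspace (Euclidean_space n). \<forall>i<n. x i \<in> B i}
    = (\<Prod>i<n. \<integral>\<^sup>+ t \<in> B i. ennreal (std_normal_density t) \<partial>lborel)"
proof -
  let ?N = "std_normal_distribution"
  let ?S = "{x \<in> topspace (Euclidean_space n). \<forall>i<n. x i \<in> B i}"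
  interpret N: prob_space ?N by (rule prob_space_normal_density) simp
  interpret P: product_prob_space "\<lambda>_. ?N" "{..<n}" by unfold_locales
  have coord: "(\<lambda>x::nat \<Rightarrow> real. x i) \<in> borel_measurable borel" for i
    by (intro borel_measurable_continuous_onI continuous_on_product_coordinates)
  have "{x \<in> space borel. \<forall>i\<in>{..<n}. x i \<in> B i} \<in> sets (borel :: (nat \<Rightarrow> real) measure)"
  proof (rule sets.sets_Collect_finite_All)
    fix i assume "i \<in> {..<n}"
    then have "(\<lambda>x::nat \<Rightarrow> real. x i) -` B i \<inter> space borel \<in> sets borel"
      using assms by (intro measurable_sets[OF coord]) simp
    then show "{x \<in> space borel. x i \<in> B i} \<in> sets (borel :: (nat \<Rightarrow> real) measure)"
      by (simp add: vimage_def)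
  qed simp
  then have "{x :: nat \<Rightarrow> real. \<forall>i<n. x i \<in> B i} \<in> sets borel"
    by (simp only: space_borel UNIV_I simp_thms lessThan_iff Ball_def)
  then have S: "?S \<in> sets (restrict_space borel (topspace (Euclidean_space n)))"
    unfolding sets_restrict_space by (rule image_eqI[rotated]) blast
  have "emeasure (std_gaussian n) ?S = emeasure (Pi\<^sub>M {..<n} (\<lambda>_. ?N)) (Pi\<^sub>E {..<n} B)"
    unfolding std_gaussian_def emeasure_distr[OF pad_measurable S]
    by (rule arg_cong[where f="emeasure _"])
       (auto simp: space_PiM PiE_def topspace_Euclidean_space)
  also have "\<dots> = (\<Prod>i<n. emeasure ?N (B i))"
    using assms by (intro P.emeasure_PiM) auto
  also have "\<dots> = (\<Prod>i<n. \<integral>\<^sup>+ t \<in> B i. ennreal (std_normal_density t) \<partial>lborel)"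
    using assms by (intro prod.cong refl emeasure_density) auto
  finally show ?thesis .
qed

lemma sum_sets_eq_Minkowski:
  fixes A :: "(nat \<Rightarrow> real) set"
  shows "(\<Sum>k<(q::nat). A) = {(\<lambda>i. \<Sum>k<q. a k i) | a::nat \<Rightarrow> nat \<Rightarrow> real. \<forall>k<q. a k \<in> A}"
proof -
  have pt: "(\<Sum>k<(q::nat). a k) = (\<lambda>i. \<Sum>k<q. a k i)" for a :: "nat \<Rightarrow> nat \<Rightarrow> real"
    by (induction q) (auto simp: zero_fun_def plus_fun_def)
  have "(\<Sum>k<q. A) = {\<Sum>k<q. a k | a. \<forall>k<q. a k \<in> A}"
    by (subst set_sum_alt) auto
  then show ?thesis by (simp only: pt)
qed

end

theory Submission
  imports Defs
begin

text \<open>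
  The idea is that a Gaussian vector \<open>z\<close> and its reflection \<open>x - z\<close> add up to \<open>x\<close>, so that \<open>x\<close> lies in
  \<open>A + A\<close> as soon as both summands are in \<open>A\<close> with positive probability. Since \<open>A\<close> has measure at least
  \<open>2/3\<close>, this holds if the law of \<open>x - z\<close>, the Gaussian measure centred at \<open>x\<close>, gives \<open>A\<close> mass
  more than \<open>1/3\<close>. For short \<open>x\<close> it does, so \<open>A + A\<close> contains a ball of constant radius.
  
  A longer \<open>x\<close> may fail, for instance when \<open>A\<close> is a half-space, but not many mutually orthogonal
  ones can. If \<open>x\<close> ranges over \<open>k\<close> orthogonal vectors of squared length at most \<open>\<rho>\<close>, then the
  mixture of the \<open>k\<close> shifted Gaussian measures has a density close to \<open>1\<close> in \<open>L\<^sup>2\<close>, provided that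
  \<open>exp \<rho>\<close> is small against \<open>k\<close>; hence one of the shifted measures gives \<open>A\<close> nearly its Gaussian
  mass (\<open>exists_orthogonal_in_sumset\<close>). A maximal orthogonal family of vectors that fail therefore
  spans a space \<open>V\<close> of dimension less than \<open>k\<close>, and on the orthogonal complement of \<open>V\<close> the set \<open>A + A\<close>
  contains a ball of radius of order \<open>sqrt (ln k)\<close> (\<open>exists_orthogonal_family\<close>).
  
  Take \<open>k\<close> near \<open>sqrt n\<close> and let \<open>E\<close> be the ellipsoid with semi-axes of order \<open>sqrt k\<close> in \<open>V\<close> and
  \<open>sqrt n\<close> in its complement. Its measure is at least \<open>1/2\<close> by Markov's inequality
  (\<open>measure_ellipsoid_ge_half\<close>). Dilation by \<open>sqrt (ln n / n)\<close> makes it bounded along \<open>V\<close> and of size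
  \<open>sqrt (ln n)\<close> across \<open>V\<close>, so a fixed number of copies of the two balls inside \<open>A + A\<close> covers it
  (\<open>add_mem_iterated_sumset\<close>).
\<close>

section \<open>Orthogonality in Euclidean space\<close>

definition ip :: "nat \<Rightarrow> (nat \<Rightarrow> real) \<Rightarrow> (nat \<Rightarrow> real) \<Rightarrow> real" where
  "ip n x y = (\<Sum>i<n. x i * y i)"

lemma ip_commute: "ip n x y = ip n y x"
  by (simp add: ip_def mult.commute)

lemma ip_scale: "ip n (\<lambda>i. c * x i) (\<lambda>i. c * x i) = c\<^sup>2 * ip n x x"
  by (simp add: ip_def sum_distrib_left power2_eq_square ac_simps)

lemma ip_sum_left: "ip n (\<lambda>i. \<Sum>v\<in>X. a v * b v i) y = (\<Sum>v\<in>X. a v * ip n (b v) y)"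
proof -
  have "ip n (\<lambda>i. \<Sum>v\<in>X. a v * b v i) y = (\<Sum>i<n. \<Sum>v\<in>X. a v * (b v i * y i))"
    by (simp add: ip_def sum_distrib_right mult.assoc)
  also have "\<dots> = (\<Sum>v\<in>X. \<Sum>i<n. a v * (b v i * y i))" by (rule sum.swap)
  finally show ?thesis by (simp add: ip_def sum_distrib_left)
qed

lemma ip_diff_left: "ip n (\<lambda>i. x i - y i) z = ip n x z - ip n y z"
  by (simp add: ip_def left_diff_distrib sum_subtractf)

lemma ip_diff_right: "ip n z (\<lambda>i. x i - y i) = ip n z x - ip n z y"
  by (simp add: ip_def right_diff_distrib sum_subtractf)

lemma ip_self_nonneg: "0 \<le> ip n x x"
  by (simp add: ip_def sum_nonneg)

definition orthogonal_family :: "nat \<Rightarrow> (nat \<Rightarrow> real) set \<Rightarrow> bool" where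
  "orthogonal_family n X \<longleftrightarrow> finite X \<and> X \<subseteq> topspace (Euclidean_space n)
     \<and> (\<forall>v\<in>X. ip n v v > 0) \<and> (\<forall>v\<in>X. \<forall>w\<in>X. v \<noteq> w \<longrightarrow> ip n v w = 0)"

text \<open>
  Here \<open>p\<close> is the orthogonal projection of \<open>x\<close> to the span of \<open>X\<close>.
\<close>
lemma orthogonal_decomposition:
  fixes x :: "nat \<Rightarrow> real"
  assumes "orthogonal_family n X" and p_def: "p = (\<lambda>i. \<Sum>v\<in>X. ip n x v / ip n v v * v i)"
  shows "ip n p p = (\<Sum>v\<in>X. (ip n x v)\<^sup>2 / ip n v v)"
    and "\<forall>v\<in>X. ip n (\<lambda>i. x i - p i) v = 0"
    and "ip n (\<lambda>i. x i - p i) (\<lambda>i. x i - p i) \<le> ip n x x"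
proof -
  have X: "finite X" "\<And>v. v \<in> X \<Longrightarrow> ip n v v > 0"
    and orth: "\<And>v w. v \<in> X \<Longrightarrow> w \<in> X \<Longrightarrow> v \<noteq> w \<Longrightarrow> ip n v w = 0"
    using assms(1) by (auto simp: orthogonal_family_def)
  have pv: "ip n p v = ip n x v" if "v \<in> X" for v
  proof -
    have "ip n p v = (\<Sum>w\<in>X. ip n x w / ip n w w * ip n w v)"
      unfolding p_def by (rule ip_sum_left)
    also have "\<dots> = (\<Sum>w\<in>X. if w = v then ip n x v else 0)"
      using orth that X(2)[OF that] by (intro sum.cong refl) auto
    finally show ?thesis using that X(1) by simp
  qed
  have s: "ip n p y = (\<Sum>v\<in>X. ip n x v / ip n v v * ip n v y)" for y
    unfolding p_def by (rule ip_sum_left)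
  show pp: "ip n p p = (\<Sum>v\<in>X. (ip n x v)\<^sup>2 / ip n v v)"
    unfolding s[of p] by (intro sum.cong refl) (simp add: ip_commute[of n _ p] pv power2_eq_square)
  have px: "ip n p x = ip n p p"
    unfolding pp s[of x] by (intro sum.cong refl) (simp add: ip_commute[of n _ x] power2_eq_square)
  show "\<forall>v\<in>X. ip n (\<lambda>i. x i - p i) v = 0"
    using pv by (simp add: ip_diff_left)
  show "ip n (\<lambda>i. x i - p i) (\<lambda>i. x i - p i) \<le> ip n x x"
    using px ip_self_nonneg[of n p] by (simp add: ip_diff_left ip_diff_right ip_commute[of n x p])
qed

section \<open>Shifted Gaussian measures\<close>

abbreviation gauss_prod :: "nat \<Rightarrow> (nat \<Rightarrow> real) measure" where
  "gauss_prod n \<equiv> Pi\<^sub>M {..<n} (\<lambda>_. std_normal_distribution)"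

text \<open>
  The density of the Gaussian measure with mean \<open>x\<close> relative to the standard one.
\<close>
definition tilt :: "nat \<Rightarrow> (nat \<Rightarrow> real) \<Rightarrow> (nat \<Rightarrow> real) \<Rightarrow> real" where
  "tilt n x z = (\<Prod>i<n. exp (x i * z i - (x i)\<^sup>2 / 2))"

lemma product_sigma_finite_std_normal:
  "product_sigma_finite (\<lambda>_::nat. std_normal_distribution)"
proof -
  interpret N: prob_space std_normal_distribution by (rule prob_space_normal_density) simp
  show ?thesis by unfold_locales
qed

lemma prob_space_gauss_prod: "prob_space (gauss_prod n)"
  by (intro prob_space_PiM prob_space_normal_density) simp

lemma std_normal_density_tilt:
  "std_normal_density t * exp (s * t - s\<^sup>2 / 2) = normal_density s 1 t"
  by (simp add: normal_density_def exp_add[symmetric] power2_eq_square field_simps)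

lemma has_integral_exp_std_normal:
  "has_bochner_integral std_normal_distribution (\<lambda>t. exp (s * t)) (exp (s\<^sup>2 / 2))"
proof -
  have "has_bochner_integral lborel (normal_density s 1) 1"
    using integral_normal_density[of 1 s] integrable_normal_density[of 1 s]
    by (simp add: has_bochner_integral_iff)
  then have "has_bochner_integral lborel (\<lambda>t. exp (s\<^sup>2 / 2) * normal_density s 1 t) (exp (s\<^sup>2 / 2) * 1)"
    by (intro has_bochner_integral_mult_right)
  moreover have "exp (s\<^sup>2 / 2) * normal_density s 1 t = std_normal_density t *\<^sub>R exp (s * t)" for t
    unfolding std_normal_density_tilt[of t s, symmetric] by (simp add: exp_diff)
  ultimately have "has_bochner_integral lborel (\<lambda>t. std_normal_density t *\<^sub>R exp (s * t)) (exp (s\<^sup>2 / 2))"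
    by simp
  then show ?thesis
    by (intro has_bochner_integral_density) (auto simp: normal_density_nonneg)
qed

text \<open>
  This correlation formula is what makes orthogonal shifts useful: for orthogonal \<open>x\<close> and \<open>y\<close> the two
  densities are uncorrelated, while a single density has second moment only \<open>exp \<bar>x\<bar>\<^sup>2\<close>.
\<close>
lemma has_integral_tilt_mult:
  "has_bochner_integral (gauss_prod n) (\<lambda>z. tilt n x z * tilt n y z) (exp (ip n x y))"
proof -
  interpret P: product_sigma_finite "\<lambda>_::nat. std_normal_distribution"
    by (rule product_sigma_finite_std_normal)
  define f where "f i t = exp (- ((x i)\<^sup>2 + (y i)\<^sup>2) / 2) * exp ((x i + y i) * t)" for i and t :: real
  have f: "has_bochner_integral std_normal_distribution (f i) (exp (x i * y i))" for i
  proof -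
    have "has_bochner_integral std_normal_distribution (f i)
        (exp (- ((x i)\<^sup>2 + (y i)\<^sup>2) / 2) * exp ((x i + y i)\<^sup>2 / 2))"
      unfolding f_def by (intro has_bochner_integral_mult_right has_integral_exp_std_normal)
    also have "exp (- ((x i)\<^sup>2 + (y i)\<^sup>2) / 2) * exp ((x i + y i)\<^sup>2 / 2) = exp (x i * y i)"
      by (simp add: exp_add[symmetric] power2_eq_square field_simps)
    finally show ?thesis .
  qed
  have "(\<lambda>z. tilt n x z * tilt n y z) = (\<lambda>z. \<Prod>i<n. f i (z i))"
    unfolding tilt_def f_def prod.distrib[symmetric]
    by (intro ext prod.cong refl, unfold exp_add[symmetric]) (rule arg_cong[where f=exp], algebra)
  moreover have "integrable (gauss_prod n) (\<lambda>z. \<Prod>i<n. f i (z i))"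
    by (rule P.product_integrable_prod[OF finite_lessThan integrable.intros[OF f]])
  moreover have "(\<integral>z. (\<Prod>i<n. f i (z i)) \<partial>gauss_prod n) = exp (ip n x y)"
    unfolding P.product_integral_prod[OF finite_lessThan integrable.intros[OF f]]
      has_bochner_integral_integral_eq[OF f] by (simp add: ip_def exp_sum)
  ultimately show ?thesis by (simp only: has_bochner_integral_iff simp_thms)
qed

lemma has_integral_tilt: "has_bochner_integral (gauss_prod n) (tilt n x) 1"
proof -
  have "tilt n (\<lambda>_. 0) z = 1" and "ip n x (\<lambda>_. 0) = 0" for z
    by (simp_all add: tilt_def ip_def)
  then show ?thesis
    using has_integral_tilt_mult[of n x "\<lambda>_. 0"] by simp
qed

lemma measurable_tilt [measurable]: "tilt n x \<in> borel_measurable (gauss_prod n)"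
  using has_integral_tilt by (rule borel_measurable_has_bochner_integral)

lemma tilt_nonneg: "0 \<le> tilt n x z"
  by (simp add: tilt_def prod_nonneg)

lemma distr_reflect_std_normal:
  "distr std_normal_distribution borel (\<lambda>t. s - t) = density lborel (normal_density s 1)"
proof -
  interpret N: prob_space std_normal_distribution by (rule prob_space_normal_density) simp
  have id: "distributed std_normal_distribution lborel (\<lambda>t. t) std_normal_density"
    unfolding distributed_def by (auto simp: distr_id2 intro!: measure_eqI)
  have "distributed std_normal_distribution lborel (\<lambda>t. s + (-1) * t) (normal_density (s + (-1) * 0) (\<bar>-1\<bar> * 1))"
    by (rule N.normal_density_affine[OF id]) auto
  then have "distr std_normal_distribution lborel (\<lambda>t. s - t) = density lborel (normal_density s 1)"
    by (simp add: distributed_def)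
  moreover have "distr std_normal_distribution borel (\<lambda>t. s - t) = distr std_normal_distribution lborel (\<lambda>t. s - t)"
    by (rule distr_cong) auto
  ultimately show ?thesis by simp
qed

lemma measurable_reflect:
  "(\<lambda>z. \<lambda>i\<in>{..<n}. x i - z i) \<in> gauss_prod n \<rightarrow>\<^sub>M gauss_prod n"
  by (rule measurable_restrict) simp

text \<open>
  The reflection \<open>z \<mapsto> x - z\<close> rather than the translation \<open>z \<mapsto> z + x\<close> is used, since \<open>z\<close> and
  \<open>x - z\<close> are to be the two summands of \<open>x\<close>. By the symmetry of the Gaussian measure both maps have the same law.
\<close>
lemma distr_reflect_gauss_prod:
  "distr (gauss_prod n) (gauss_prod n) (\<lambda>z. \<lambda>i\<in>{..<n}. x i - z i)
   = density (gauss_prod n) (\<lambda>z. ennreal (tilt n x z))"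
proof -
  interpret P: product_sigma_finite "\<lambda>_::nat. std_normal_distribution"
    by (rule product_sigma_finite_std_normal)
  define M where "M = (\<lambda>i. density lborel (normal_density (x i) 1))"
  have prob: "prob_space (M i)" for i
    unfolding M_def by (rule prob_space_normal_density) simp
  interpret Q: product_sigma_finite M
    using prob prob_space_imp_sigma_finite by unfold_locales (auto simp: sigma_finite_measure_def)
  have setsM: "sets (M i) = sets borel" for i by (simp add: M_def)
  have setsPi: "sets (gauss_prod n) = sets (Pi\<^sub>M {..<n} M)"
    by (intro sets_PiM_cong) (auto simp: setsM)
  have "distr (gauss_prod n) (gauss_prod n) (\<lambda>z. \<lambda>i\<in>{..<n}. x i - z i) = Pi\<^sub>M {..<n} M"
  proof (rule Q.PiM_eqI)
    fix A assume "\<And>i. i \<in> {..<n} \<Longrightarrow> A i \<in> sets (M i)"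
    then have A: "\<And>i. i < n \<Longrightarrow> A i \<in> sets borel" by (simp add: setsM)
    have box: "Pi\<^sub>E {..<n} A \<in> sets (gauss_prod n)"
      using A by (intro sets_PiM_I_finite) auto
    have pre: "(\<lambda>t. x i - t) -` A i \<in> sets borel" if "i < n" for i
      using measurable_sets_borel[of "\<lambda>t. x i - t", OF _ A[OF that]] by simp
    have "emeasure (distr (gauss_prod n) (gauss_prod n) (\<lambda>z. \<lambda>i\<in>{..<n}. x i - z i)) (Pi\<^sub>E {..<n} A)
        = emeasure (gauss_prod n) (Pi\<^sub>E {..<n} (\<lambda>i. (\<lambda>t. x i - t) -` A i))"
      unfolding emeasure_distr[OF measurable_reflect box]
      by (rule arg_cong[where f="emeasure _"]) (auto simp: space_PiM PiE_iff)
    also have "\<dots> = (\<Prod>i<n. emeasure std_normal_distribution ((\<lambda>t. x i - t) -` A i))"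
      using pre by (intro P.emeasure_PiM) auto
    also have "\<dots> = (\<Prod>i<n. emeasure (M i) (A i))"
    proof (intro prod.cong refl)
      fix i assume "i \<in> {..<n}"
      then have "A i \<in> sets borel" using A by simp
      then show "emeasure std_normal_distribution ((\<lambda>t. x i - t) -` A i) = emeasure (M i) (A i)"
        unfolding M_def distr_reflect_std_normal[of "x i", symmetric]
        by (subst emeasure_distr) auto
    qed
    finally show "emeasure (distr (gauss_prod n) (gauss_prod n) (\<lambda>z. \<lambda>i\<in>{..<n}. x i - z i)) (Pi\<^sub>E {..<n} A)
        = (\<Prod>i<n. emeasure (M i) (A i))" .
  qed (auto simp: setsPi)
  moreover have "density (gauss_prod n) (\<lambda>z. ennreal (tilt n x z)) = Pi\<^sub>M {..<n} M"
  proof (rule Q.PiM_eqI)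
    fix A assume "\<And>i. i \<in> {..<n} \<Longrightarrow> A i \<in> sets (M i)"
    then have A: "\<And>i. i < n \<Longrightarrow> A i \<in> sets borel" by (simp add: setsM)
    have box: "Pi\<^sub>E {..<n} A \<in> sets (gauss_prod n)"
      using A by (intro sets_PiM_I_finite) auto
    define g where "g i t = ennreal (exp (x i * t - (x i)\<^sup>2 / 2)) * indicator (A i) t" for i t
    have dens: "M i = density std_normal_distribution (\<lambda>t. ennreal (exp (x i * t - (x i)\<^sup>2 / 2)))" for i
      unfolding M_def
      by (subst density_density_eq)
         (auto simp: ennreal_mult'[symmetric] normal_density_nonneg std_normal_density_tilt)
    have "emeasure (density (gauss_prod n) (\<lambda>z. ennreal (tilt n x z))) (Pi\<^sub>E {..<n} A)
        = (\<integral>\<^sup>+ z. ennreal (tilt n x z) * indicator (Pi\<^sub>E {..<n} A) z \<partial>gauss_prod n)"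
      using box by (intro emeasure_density) auto
    also have "\<dots> = (\<integral>\<^sup>+ z. (\<Prod>i<n. g i (z i)) \<partial>gauss_prod n)"
    proof (rule nn_integral_cong)
      fix z assume "z \<in> space (gauss_prod n)"
      then have "indicator (Pi\<^sub>E {..<n} A) z = (\<Prod>i<n. indicator (A i) (z i) :: ennreal)"
        by (auto simp: space_PiM PiE_iff indicator_def prod_zero_iff)
      then show "ennreal (tilt n x z) * indicator (Pi\<^sub>E {..<n} A) z = (\<Prod>i<n. g i (z i))"
        by (simp add: g_def tilt_def prod.distrib prod_ennreal)
    qed
    also have "\<dots> = (\<Prod>i<n. \<integral>\<^sup>+ t. g i t \<partial>std_normal_distribution)"
      using A by (intro P.product_nn_integral_prod) (auto simp: g_def)
    also have "\<dots> = (\<Prod>i<n. emeasure (M i) (A i))"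
      using A by (intro prod.cong refl) (simp add: dens emeasure_density g_def)
    finally show "emeasure (density (gauss_prod n) (\<lambda>z. ennreal (tilt n x z))) (Pi\<^sub>E {..<n} A)
        = (\<Prod>i<n. emeasure (M i) (A i))" .
  qed (auto simp: setsPi)
  ultimately show ?thesis by simp
qed

lemma measure_reflect:
  assumes B: "B \<in> sets (gauss_prod n)"
  shows "measure (gauss_prod n) {z \<in> space (gauss_prod n). (\<lambda>i\<in>{..<n}. x i - z i) \<in> B}
    = (\<integral>z. tilt n x z * indicator B z \<partial>gauss_prod n)"
proof -
  have "measure (gauss_prod n) {z \<in> space (gauss_prod n). (\<lambda>i\<in>{..<n}. x i - z i) \<in> B}
      = measure (distr (gauss_prod n) (gauss_prod n) (\<lambda>z. \<lambda>i\<in>{..<n}. x i - z i)) B"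
    unfolding measure_distr[OF measurable_reflect B]
    by (rule arg_cong[where f="measure _"]) auto
  also have "\<dots> = (\<integral>z. indicator B z \<partial>density (gauss_prod n) (\<lambda>z. ennreal (tilt n x z)))"
    unfolding distr_reflect_gauss_prod
    using B sets.sets_into_space[OF B] by (simp add: Int_absorb2)
  also have "\<dots> = (\<integral>z. tilt n x z * indicator B z \<partial>gauss_prod n)"
    using B by (subst integral_density)
      (auto simp: tilt_nonneg)
  finally show ?thesis .
qed

section \<open>Vectors in the sum of two copies\<close>

text \<open>
  It suffices to find \<open>x \<in> X\<close> for which a Gaussian vector \<open>z\<close> satisfies both \<open>z \<in> A\<close> and
  \<open>x - z \<in> A\<close> with positive probability. The first event has probability at least \<open>2/3\<close>, so the
  second need only exceed \<open>1/3\<close> for one \<open>x\<close>, hence only on average over \<open>X\<close>. The average is the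
  measure of \<open>A\<close> under the mixture of the Gaussian measures centred at the points of \<open>X\<close>. The
  density of this mixture is an average of uncorrelated functions, so its distance from \<open>1\<close> in
  \<open>L\<^sup>2\<close> squared is at most \<open>max (exp \<bar>x\<bar>\<^sup>2 - 1) / card X < 1/9\<close>, and by Cauchy-Schwarz
  the mixture gives \<open>A\<close> more than \<open>2/3 - 1/3\<close>.
\<close>
lemma exists_orthogonal_in_sumset:
  assumes A: "closedin (Euclidean_space n) A" "2 / 3 \<le> measure (std_gaussian n) A"
    and X: "finite X" "X \<noteq> {}" "X \<subseteq> topspace (Euclidean_space n)"
    and orth: "\<And>x y. x \<in> X \<Longrightarrow> y \<in> X \<Longrightarrow> x \<noteq> y \<Longrightarrow> ip n x y = 0"
    and small: "\<And>x. x \<in> X \<Longrightarrow> exp (ip n x x) - 1 < real (card X) / 9"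
  shows "\<exists>x\<in>X. x \<in> A + A"
proof -
  interpret P: prob_space "gauss_prod n" by (rule prob_space_gauss_prod)
  let ?P = "gauss_prod n"
  define pad where "pad = (\<lambda>z::nat \<Rightarrow> real. \<lambda>i. if i < n then z i else 0)"
  define B where "B = pad -` A \<inter> space ?P"
  define k where "k = real (card X)"
  define F where "F = (\<lambda>z. \<Sum>x\<in>X. tilt n x z)"
  have k: "k > 0" using X by (simp add: k_def card_gt_0_iff)
  have A': "A \<in> sets (restrict_space borel (topspace (Euclidean_space n)))"
    using closedin_sets_std_gaussian[OF A(1)] by (simp add: std_gaussian_def)
  have B: "B \<in> sets ?P"
    unfolding B_def pad_def by (rule measurable_sets[OF pad_measurable A'])
  have mB: "2 / 3 \<le> measure ?P B"
    using A(2) by (simp add: std_gaussian_def measure_distr[OF pad_measurable A'] B_def pad_def)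
  have F1: "has_bochner_integral ?P F k"
    using has_bochner_integral_sum[of X ?P "tilt n" "\<lambda>_. 1"] has_integral_tilt
    by (simp add: F_def k_def)
  define S where "S = (\<Sum>x\<in>X. \<Sum>y\<in>X. exp (ip n x y))"
  have F2: "has_bochner_integral ?P (\<lambda>z. (F z)\<^sup>2) S"
    unfolding F_def S_def power2_eq_square sum_product
    by (intro has_bochner_integral_sum has_integral_tilt_mult)
  have "S - k\<^sup>2 = (\<Sum>x\<in>X. \<Sum>y\<in>X. exp (ip n x y) - 1)"
    by (simp add: S_def k_def sum_subtractf power2_eq_square)
  also have "\<dots> = (\<Sum>x\<in>X. \<Sum>y\<in>X. if y = x then exp (ip n x x) - 1 else 0)"
    using orth by (intro sum.cong refl) auto
  also have "\<dots> = (\<Sum>x\<in>X. exp (ip n x x) - 1)"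
    using X by simp
  also have "\<dots> < (\<Sum>x\<in>X. k / 9)"
    using X small by (intro sum_strict_mono) (auto simp: k_def)
  also have "\<dots> = k * k / 9" by (simp add: k_def)
  finally have S: "S - k\<^sup>2 < k * k / 9" .
  (* Cauchy-Schwarz is replaced by a pointwise bound: with u = F z / k - 1 the
     inequality 0 <= (3 / 2) (u + 1 / 3)^2 bounds u from below by a quadratic with
     a computable integral. *)
  define G where "G z = k * indicator B z - k / 6 - 3 / (2 * k) * ((F z)\<^sup>2 - 2 * k * F z + k\<^sup>2)" for z
  have intB: "has_bochner_integral ?P (indicator B) (measure ?P B)"
    using B by (intro has_bochner_integral_real_indicator) (auto simp: P.emeasure_finite less_top[symmetric])
  have const: "has_bochner_integral ?P (\<lambda>_. c) c" for c :: real
    by (simp add: has_bochner_integral_iff P.prob_space)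
  have G: "has_bochner_integral ?P G (k * measure ?P B - k / 6 - 3 / (2 * k) * (S - 2 * k * k + k\<^sup>2))"
    unfolding G_def
    by (intro has_bochner_integral_diff has_bochner_integral_add has_bochner_integral_mult_right
        intB const F1 F2)
  have FB: "integrable ?P (\<lambda>z. tilt n x z * indicator B z)" for x
    using has_integral_tilt[of n x] B by (intro integrable_real_mult_indicator) (auto simp: has_bochner_integral_iff)
  have le: "G z \<le> (\<Sum>x\<in>X. tilt n x z * indicator B z)" for z
  proof -
    have "(\<Sum>x\<in>X. tilt n x z * indicator B z) = F z * indicator B z"
      by (simp add: F_def sum_distrib_right)
    moreover have "G z \<le> F z * indicator B z"
    proof (cases "z \<in> B")
      case True
      have "0 \<le> 3 / (2 * k) * (F z - k + k / 3)\<^sup>2" using k by simp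
      also have "\<dots> = F z - G z"
        using True k by (simp add: G_def field_simps power2_eq_square)
      finally show ?thesis using True by simp
    next
      case False
      have "G z = - k / 6 - 3 / (2 * k) * (F z - k)\<^sup>2"
        using False by (simp add: G_def power2_diff algebra_simps)
      moreover have "0 \<le> 3 / (2 * k) * (F z - k)\<^sup>2" using k by simp
      moreover have "F z * indicator B z = 0" using False by simp
      ultimately show ?thesis using k by linarith
    qed
    ultimately show ?thesis by simp
  qed
  have "\<exists>x\<in>X. 1 / 3 < (\<integral>z. tilt n x z * indicator B z \<partial>?P)"
  proof (rule ccontr)
    assume "\<not> ?thesis"
    then have "(\<Sum>x\<in>X. (\<integral>z. tilt n x z * indicator B z \<partial>?P)) \<le> (\<Sum>x\<in>X. 1 / 3)"
      by (intro sum_mono) (auto simp: not_less)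
    then have up: "(\<Sum>x\<in>X. (\<integral>z. tilt n x z * indicator B z \<partial>?P)) \<le> k / 3"
      by (simp add: k_def)
    have "3 / (2 * k) * (S - 2 * k * k + k\<^sup>2) = 3 / (2 * k) * (S - k\<^sup>2)"
      by (simp add: power2_eq_square)
    also have "\<dots> < 3 / (2 * k) * (k * k / 9)"
      using S k by (intro mult_strict_left_mono) auto
    also have "\<dots> = k / 6" using k by simp
    finally have "k * measure ?P B - k / 6 - k / 6 < integral\<^sup>L ?P G"
      unfolding has_bochner_integral_integral_eq[OF G] by linarith
    moreover have "k * (2 / 3) \<le> k * measure ?P B" using mB k by simp
    moreover have "integral\<^sup>L ?P G \<le> (\<integral>z. (\<Sum>x\<in>X. tilt n x z * indicator B z) \<partial>?P)"
      using FB G le by (intro integral_mono) (auto simp: has_bochner_integral_iff)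
    moreover have "(\<integral>z. (\<Sum>x\<in>X. tilt n x z * indicator B z) \<partial>?P)
        = (\<Sum>x\<in>X. (\<integral>z. tilt n x z * indicator B z \<partial>?P))"
      using FB by (intro Bochner_Integration.integral_sum)
    ultimately show False using up by linarith
  qed
  then obtain x where x: "x \<in> X"
    and m: "1 / 3 < measure ?P {z \<in> space ?P. (\<lambda>i\<in>{..<n}. x i - z i) \<in> B}"
    unfolding measure_reflect[OF B, symmetric] by blast
  define R where "R = {z \<in> space ?P. (\<lambda>i\<in>{..<n}. x i - z i) \<in> B}"
  have "R = (\<lambda>z. \<lambda>i\<in>{..<n}. x i - z i) -` B \<inter> space ?P" by (auto simp: R_def)
  then have R: "R \<in> sets ?P" using measurable_sets[OF measurable_reflect B] by simp
  have "R \<inter> B \<noteq> {}"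
  proof
    assume "R \<inter> B = {}"
    then have "measure ?P (R \<union> B) = measure ?P R + measure ?P B"
      using R B by (intro P.finite_measure_Union)
    then show False using m mB P.prob_le_1[of "R \<union> B"] by (simp add: R_def)
  qed
  then obtain z where z: "z \<in> B" "(\<lambda>i\<in>{..<n}. x i - z i) \<in> B" by (auto simp: R_def)
  have "x = pad z + pad (\<lambda>i\<in>{..<n}. x i - z i)"
  proof
    fix i
    show "x i = (pad z + pad (\<lambda>i\<in>{..<n}. x i - z i)) i"
      using X(3) x by (auto simp: pad_def topspace_Euclidean_space plus_fun_def)
  qed
  moreover have "pad z \<in> A" "pad (\<lambda>i\<in>{..<n}. x i - z i) \<in> A" using z by (auto simp: B_def)
  ultimately show ?thesis using x set_plus_intro by metis
qed

text \<open>
  A small ball in all directions, from one-point families.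
\<close>
lemma small_vector_in_sumset:
  assumes A: "closedin (Euclidean_space n) A" "2 / 3 \<le> measure (std_gaussian n) A"
    and x: "x \<in> topspace (Euclidean_space n)" "exp (ip n x x) - 1 < 1 / 9"
  shows "x \<in> A + A"
  using exists_orthogonal_in_sumset[OF A, of "{x}"] x by auto

text \<open>
  Choose a largest orthogonal family of vectors of squared length at most \<open>\<rho>\<close> outside \<open>A + A\<close>.
  A family of \<open>k\<close> or more such vectors would contradict \<open>exists_orthogonal_in_sumset\<close>, and any further
  vector orthogonal to all of them could be added to the family unless it lies in \<open>A + A\<close>. So
  outside fewer than \<open>k\<close> exceptional directions, \<open>A + A\<close> contains the ball of squared radius \<open>\<rho>\<close>,
  where \<open>\<rho>\<close> may grow like \<open>ln k\<close>.
\<close>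
lemma exists_orthogonal_family:
  assumes A: "closedin (Euclidean_space n) A" "2 / 3 \<le> measure (std_gaussian n) A"
    and \<rho>: "exp \<rho> - 1 < real k / 9" and k: "k > 0"
  shows "\<exists>X. orthogonal_family n X \<and> card X < k
    \<and> (\<forall>x \<in> topspace (Euclidean_space n).
          (\<forall>v\<in>X. ip n x v = 0) \<longrightarrow> ip n x x \<le> \<rho> \<longrightarrow> x \<in> A + A)"
proof -
  define bad where "bad X \<longleftrightarrow> finite X
      \<and> (\<forall>v\<in>X. v \<in> topspace (Euclidean_space n) \<and> ip n v v \<le> \<rho> \<and> v \<notin> A + A)
      \<and> (\<forall>v\<in>X. \<forall>w\<in>X. v \<noteq> w \<longrightarrow> ip n v w = 0)" for X
  have card: "card X < k" if "bad X" for X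
  proof (rule ccontr)
    assume "\<not> card X < k"
    then have le: "k \<le> card X" by simp
    have "exp (ip n v v) - 1 < real (card X) / 9" if "v \<in> X" for v
    proof -
      have "exp (ip n v v) \<le> exp \<rho>" using that \<open>bad X\<close> by (simp add: bad_def)
      then show ?thesis using \<rho> le by linarith
    qed
    moreover have "X \<noteq> {}" using le k by auto
    ultimately show False
      using exists_orthogonal_in_sumset[OF A, of X] \<open>bad X\<close> unfolding bad_def by blast
  qed
  have "bad {}" by (simp add: bad_def)
  then have "\<exists>X. bad X \<and> (\<forall>Y. bad Y \<longrightarrow> card Y \<le> card X)"
    using card by (intro Lattices_Big.ex_has_greatest_nat[of bad _ card k] allI impI)
  then obtain X where X: "bad X" and max: "\<forall>Y. bad Y \<longrightarrow> card Y \<le> card X" by (elim exE conjE)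
  have fin: "finite X" using X by (simp add: bad_def)
  have pos: "ip n v v > 0" if "v \<in> X" for v
  proof (rule ccontr)
    (* the zero vector lies in A + A, being small *)
    assume "\<not> ip n v v > 0"
    then have "ip n v v = 0" using ip_self_nonneg[of n v] by linarith
    then show False
      using small_vector_in_sumset[OF A, of v] that X by (simp add: bad_def)
  qed
  have good: "x \<in> A + A"
    if x: "x \<in> topspace (Euclidean_space n)" "\<And>v. v \<in> X \<Longrightarrow> ip n x v = 0" "ip n x x \<le> \<rho>" for x
  proof (rule ccontr)
    assume "x \<notin> A + A"
    moreover have "ip n v x = 0" if "v \<in> X" for v
      using x(2)[OF that] by (simp add: ip_commute)
    ultimately have "bad (insert x X)"
      using x X unfolding bad_def by simp
    then have "card (insert x X) \<le> card X" using max by simp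
    moreover have "x \<notin> X" using x(2)[of x] pos[of x] by auto
    ultimately show False using fin by simp
  qed
  show ?thesis
  proof (intro exI[of _ X] conjI ballI impI)
    show "orthogonal_family n X"
      using X pos unfolding bad_def orthogonal_family_def by (simp add: subset_iff)
    show "card X < k" by (rule card[OF X])
  qed (rule good; simp)
qed

section \<open>Iterated Minkowski sums\<close>

lemma iterated_sumset_add:
  fixes A :: "'a::comm_monoid_add set"
  shows "(\<Sum>k<a + b. A) = (\<Sum>k<a. A) + (\<Sum>k<b::nat. A)"
  by (induction b) (simp_all add: ac_simps)

lemma mem_iterated_sumset:
  fixes S :: "(nat \<Rightarrow> real) set"
  assumes "m > 0" "(\<lambda>i. x i / real m) \<in> S"
  shows "x \<in> (\<Sum>k<m. S)"
  unfolding sum_sets_eq_Minkowski using assms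
  by (auto intro!: exI[of _ "\<lambda>_ i. x i / real m"])

text \<open>
  Splitting vectors into equal parts trades length for the number of summands.
\<close>
lemma add_mem_iterated_sumset:
  fixes A :: "(nat \<Rightarrow> real) set"
  assumes "m > 0" "(\<lambda>i. x i / real m) \<in> A + A" "(\<lambda>i. y i / real m) \<in> A + A"
  shows "(\<lambda>i. x i + y i) \<in> (\<Sum>k<4 * m. A)"
proof -
  have "4 * m = (m + m) + (m + m)" by simp
  then have "(\<Sum>k<4 * m. A) = (\<Sum>k<(m + m) + (m + m). A)" by (simp only:)
  also have "\<dots> = (\<Sum>k<m. A + A) + (\<Sum>k<m. A + A)"
    by (simp only: iterated_sumset_add sum.distrib)
  finally have "(\<Sum>k<4 * m. A) = (\<Sum>k<m. A + A) + (\<Sum>k<m. A + A)" .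
  moreover have "(\<lambda>i. x i + y i) = x + y" by (simp add: plus_fun_def)
  ultimately show ?thesis
    using mem_iterated_sumset[OF assms(1,2)] mem_iterated_sumset[OF assms(1,3)]
    by (simp add: set_plus_intro)
qed

section \<open>Gaussian measure of ellipsoids\<close>

text \<open>
  The product \<open>z i * z j\<close> is written as a product over all coordinates, so that Fubini applies
  to it as to any other product function.
\<close>
lemma has_integral_coordinate_mult:
  assumes "i < n" "j < n"
  shows "has_bochner_integral (gauss_prod n) (\<lambda>z. z i * z j) (if i = j then 1 else 0)"
proof -
  interpret P: product_sigma_finite "\<lambda>_::nat. std_normal_distribution"
    by (rule product_sigma_finite_std_normal)
  define f where "f l t = (if l = i then t else 1) * (if l = j then t else (1::real))" for l t
  define a :: "nat \<Rightarrow> real" where "a l = (if l = i \<longleftrightarrow> l = j then 1 else 0)" for l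
  have m0: "has_bochner_integral std_normal_distribution (\<lambda>t. 1) (1::real)"
  proof -
    interpret N: prob_space std_normal_distribution by (rule prob_space_normal_density) simp
    show ?thesis using N.prob_space by (simp add: has_bochner_integral_iff)
  qed
  have m1: "has_bochner_integral std_normal_distribution (\<lambda>t. t) (0::real)"
    using std_normal_moment_odd[of 0]
    by (intro has_bochner_integral_density) (auto simp: normal_density_nonneg)
  have m2: "has_bochner_integral std_normal_distribution (\<lambda>t. t * t) (1::real)"
    using std_normal_moment_even[of 1]
    by (intro has_bochner_integral_density) (auto simp: normal_density_nonneg power2_eq_square)
  have f: "has_bochner_integral std_normal_distribution (f l) (a l)" for l
    using m0 m1 m2 by (cases "l = i"; cases "l = j") (simp_all add: f_def[abs_def] a_def)
  have "(\<lambda>z. z i * z j) = (\<lambda>z. \<Prod>l<n. f l (z l))"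
    using assms by (simp add: f_def prod.distrib prod.delta)
  moreover have "integrable (gauss_prod n) (\<lambda>z. \<Prod>l<n. f l (z l))"
    by (rule P.product_integrable_prod[OF finite_lessThan integrable.intros[OF f]])
  moreover have "(\<integral>z. (\<Prod>l<n. f l (z l)) \<partial>gauss_prod n) = (\<Prod>l<n. a l)"
    unfolding P.product_integral_prod[OF finite_lessThan integrable.intros[OF f]]
      has_bochner_integral_integral_eq[OF f] ..
  moreover have "(\<Prod>l<n. a l) = (if i = j then 1 else 0)"
    using assms by (auto simp: a_def prod_zero_iff intro!: prod.neutral)
  ultimately show ?thesis by (simp only: has_bochner_integral_iff simp_thms)
qed

lemma has_integral_quad_form:
  "has_bochner_integral (std_gaussian n) (quad_form n Q) (\<Sum>i<n. Q i i)"
proof -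
  let ?pad = "\<lambda>z::nat \<Rightarrow> real. \<lambda>i. if i < n then z i else 0"
  have coord: "(\<lambda>x::nat \<Rightarrow> real. x i) \<in> borel_measurable (restrict_space borel (topspace (Euclidean_space n)))" for i
    by (intro measurable_restrict_space1 borel_measurable_continuous_onI continuous_on_product_coordinates)
  have meas: "quad_form n Q \<in> borel_measurable (restrict_space borel (topspace (Euclidean_space n)))"
    unfolding quad_form_def[abs_def] by (intro borel_measurable_sum borel_measurable_times coord) auto
  have "has_bochner_integral (gauss_prod n) (\<lambda>z. \<Sum>i<n. \<Sum>j<n. Q i j * (z i * z j))
      (\<Sum>i<n. \<Sum>j<n. Q i j * (if i = j then 1 else 0))"
    by (intro has_bochner_integral_sum has_bochner_integral_mult_right has_integral_coordinate_mult) auto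
  moreover have "(\<lambda>z. \<Sum>i<n. \<Sum>j<n. Q i j * (z i * z j)) = (\<lambda>z. quad_form n Q (?pad z))"
    by (intro ext) (auto simp: quad_form_def ac_simps intro!: sum.cong)
  moreover have "(\<Sum>i<n. \<Sum>j<n. Q i j * (if i = j then 1 else 0)) = (\<Sum>i<n. Q i i)"
    by (intro sum.cong refl) (simp add: if_distrib cong: if_cong)
  ultimately have "has_bochner_integral (gauss_prod n) (\<lambda>z. quad_form n Q (?pad z)) (\<Sum>i<n. Q i i)"
    by simp
  then show ?thesis
    unfolding std_gaussian_def
    by (simp add: has_bochner_integral_iff integrable_distr_eq[OF pad_measurable meas]
        integral_distr[OF pad_measurable meas])
qed

text \<open>
  The trace of \<open>Q\<close> is the mean of its quadratic form under the Gaussian measure, so this is Markov's inequality.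
\<close>
lemma measure_ellipsoid_ge_half:
  assumes "sym_psd n Q" "(\<Sum>i<n. Q i i) \<le> 1 / 2"
  shows "1 / 2 \<le> measure (std_gaussian n) {x \<in> topspace (Euclidean_space n). quad_form n Q x \<le> 1}"
proof -
  interpret G: prob_space "std_gaussian n" by (rule prob_space_std_gaussian)
  have int: "integrable (std_gaussian n) (quad_form n Q)"
    and eq: "integral\<^sup>L (std_gaussian n) (quad_form n Q) = (\<Sum>i<n. Q i i)"
    using has_integral_quad_form[of n Q] by (auto simp: has_bochner_integral_iff)
  note [measurable] = borel_measurable_integrable[OF int]
  let ?L = "{x \<in> space (std_gaussian n). quad_form n Q x \<le> 1}"
  have "measure (std_gaussian n) {x \<in> space (std_gaussian n). quad_form n Q x \<ge> 1}
      \<le> integral\<^sup>L (std_gaussian n) (quad_form n Q) / 1"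
    using int assms(1)
    by (intro integral_Markov_inequality_measure[where A="{}"] AE_I2)
       (auto simp: sym_psd_def space_std_gaussian)
  then have "measure (std_gaussian n) {x \<in> space (std_gaussian n). quad_form n Q x \<ge> 1} \<le> 1 / 2"
    using assms(2) eq by simp
  moreover have "measure (std_gaussian n) (space (std_gaussian n) - ?L)
      \<le> measure (std_gaussian n) {x \<in> space (std_gaussian n). quad_form n Q x \<ge> 1}"
    by (intro G.finite_measure_mono) auto
  moreover have "measure (std_gaussian n) (space (std_gaussian n) - ?L) = 1 - measure (std_gaussian n) ?L"
    by (intro G.prob_compl) auto
  ultimately show ?thesis by (simp add: space_std_gaussian)
qed

text \<open>
  The matrix is \<open>a\<close> times the identity plus \<open>b\<close> times the orthogonal projection to the span of
  \<open>X\<close> (for orthogonal \<open>X\<close>), and the last sum is the squared length of the projection of \<open>x\<close>.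
\<close>
lemma quad_form_orthogonal_family:
  "quad_form n (\<lambda>i j. (if i = j then a else 0) + b * (\<Sum>v\<in>X. v i * v j / ip n v v)) x
    = a * ip n x x + b * (\<Sum>v\<in>X. (ip n x v)\<^sup>2 / ip n v v)"
proof -
  have "quad_form n (\<lambda>i j. (if i = j then a else 0) + b * (\<Sum>v\<in>X. v i * v j / ip n v v)) x
     = (\<Sum>i<n. \<Sum>j<n. if i = j then a * (x i * x j) else 0)
       + (\<Sum>i<n. \<Sum>j<n. \<Sum>v\<in>X. b * ((x i * v i) * (x j * v j) / ip n v v))"
    unfolding quad_form_def sum.distrib[symmetric]
  proof (intro sum.cong refl)
    fix i j :: nat
    have "(\<Sum>v\<in>X. b * ((x i * v i) * (x j * v j) / ip n v v))
        = x i * (b * (\<Sum>v\<in>X. v i * v j / ip n v v)) * x j"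
      unfolding sum_distrib_left sum_distrib_right by (intro sum.cong refl) simp
    then show "x i * ((if i = j then a else 0) + b * (\<Sum>v\<in>X. v i * v j / ip n v v)) * x j
        = (if i = j then a * (x i * x j) else 0) + (\<Sum>v\<in>X. b * ((x i * v i) * (x j * v j) / ip n v v))"
      by (simp add: distrib_left distrib_right)
  qed
  also have "(\<Sum>i<n. \<Sum>j<n. if i = j then a * (x i * x j) else 0) = a * ip n x x"
    by (simp add: ip_def sum_distrib_left)
  also have "(\<Sum>i<n. \<Sum>j<n. \<Sum>v\<in>X. b * ((x i * v i) * (x j * v j) / ip n v v))
      = (\<Sum>v\<in>X. \<Sum>i<n. \<Sum>j<n. b * ((x i * v i) * (x j * v j) / ip n v v))"
  proof -
    have "(\<Sum>i<n. \<Sum>j<n. \<Sum>v\<in>X. g i j v) = (\<Sum>v\<in>X. \<Sum>i<n. \<Sum>j<n. g i j v)"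
      for g :: "nat \<Rightarrow> nat \<Rightarrow> (nat \<Rightarrow> real) \<Rightarrow> real"
    proof -
      have "(\<Sum>i<n. \<Sum>j<n. \<Sum>v\<in>X. g i j v) = (\<Sum>i<n. \<Sum>v\<in>X. \<Sum>j<n. g i j v)"
        by (intro sum.cong refl sum.swap)
      also have "\<dots> = (\<Sum>v\<in>X. \<Sum>i<n. \<Sum>j<n. g i j v)" by (rule sum.swap)
      finally show ?thesis .
    qed
    then show ?thesis .
  qed
  also have "\<dots> = (\<Sum>v\<in>X. b * ((ip n x v)\<^sup>2 / ip n v v))"
    unfolding power2_eq_square ip_def[of n x] sum_product
    by (simp only: sum_distrib_left sum_divide_distrib)
  also have "\<dots> = b * (\<Sum>v\<in>X. (ip n x v)\<^sup>2 / ip n v v)"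
    by (rule sum_distrib_left[symmetric])
  finally show ?thesis .
qed

lemma trace_orthogonal_family:
  assumes "orthogonal_family n X"
  shows "(\<Sum>i<n. (if i = i then a else 0) + b * (\<Sum>v\<in>X. v i * v i / ip n v v))
    = real n * a + b * real (card X)"
proof -
  have "(\<Sum>i<n. \<Sum>v\<in>X. v i * v i / ip n v v) = (\<Sum>v\<in>X. \<Sum>i<n. v i * v i / ip n v v)"
    by (rule sum.swap)
  also have "\<dots> = (\<Sum>v\<in>X. ip n v v / ip n v v)"
    unfolding sum_divide_distrib[symmetric] ip_def ..
  also have "\<dots> = (\<Sum>v\<in>X. 1)"
    using assms by (intro sum.cong refl) (simp add: orthogonal_family_def less_imp_neq[symmetric])
  finally show ?thesis by (simp add: sum.distrib sum_distrib_left[symmetric])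
qed

section \<open>The ellipsoid in the sumset\<close>

text \<open>
  The fiftieth power of \<open>exp (ln n / 100)\<close> is \<open>sqrt n\<close>, so by Bernoulli's inequality the left-hand
  side is less than \<open>sqrt n / 50\<close>.
\<close>
lemma exp_ln_hundredth_less:
  assumes "n \<ge> 1" "sqrt (real n) \<le> k"
  shows "exp (ln (real n) / 100) - 1 < k / 9"
proof -
  define t where "t = exp (ln (real n) / 100) - 1"
  have t: "0 \<le> t" using assms by (simp add: t_def)
  have "1 + real 50 * t \<le> (1 + t) ^ 50"
    using t by (intro Bernoulli_inequality) simp
  also have "\<dots> = exp (ln (real n) / 2)"
    by (simp add: t_def exp_of_nat_mult[symmetric])
  also have "\<dots> = sqrt (real n)"
    using assms by (simp add: ln_sqrt[symmetric])
  finally show ?thesis using assms(2) t by (simp add: t_def[symmetric])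
qed

lemma exp_minus_one_less_ninth:
  fixes y :: real
  assumes "y \<le> 4 / 100"
  shows "exp y - 1 < 1 / 9"
proof -
  have "exp (4 / 100) \<le> 1 + 4 / 100 + (4 / 100 :: real)\<^sup>2"
    by (rule exp_bound) auto
  moreover have "exp y \<le> exp (4 / 100)" using assms by simp
  moreover have "1 + 4 / 100 + (4 / 100)\<^sup>2 < 1 + (1 / 9 :: real)" by (simp add: power2_eq_square)
  ultimately show ?thesis by linarith
qed

theorem corollary0p7:
  shows "\<exists>q::nat. q > 0 \<and>
    (\<forall>n::nat. n \<ge> 1 \<longrightarrow>
      (\<forall>A :: (nat \<Rightarrow> real) set.
        closedin (Euclidean_space n) A \<and> measure (std_gaussian n) A \<ge> 2 / 3 \<longrightarrow>
        (\<exists>E. ellipsoid n E \<and> measure (std_gaussian n) E \<ge> 1 / 2 \<and>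
             dilate (sqrt (ln (real n) / real n)) E \<subseteq> (\<Sum>k<q. A))))"
proof (intro exI[of _ "4 * 20 :: nat"] conjI allI impI)
  show "0 < (4 * 20 :: nat)" by simp
  fix n :: nat and A :: "(nat \<Rightarrow> real) set"
  assume n: "1 \<le> n" and "closedin (Euclidean_space n) A \<and> 2 / 3 \<le> measure (std_gaussian n) A"
  then have A: "closedin (Euclidean_space n) A" "2 / 3 \<le> measure (std_gaussian n) A" by simp_all
  (* About sqrt n exceptional directions are allowed: few enough that the
     dilated ellipsoid stays bounded along them, many enough that ln k is comparable to ln n. *)
  define k where "k = nat \<lceil>sqrt (real n)\<rceil>"
  have sqrt_n: "1 \<le> sqrt (real n)" using n by simp
  have k: "sqrt (real n) \<le> real k" "real k \<le> 2 * sqrt (real n)" "k > 0"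
    using sqrt_n of_int_ceiling_le_add_one[of "sqrt (real n)"] le_of_int_ceiling[of "sqrt (real n)"]
    unfolding k_def by linarith+
  define \<rho> where "\<rho> = ln (real n) / 100"
  have \<rho>: "exp \<rho> - 1 < real k / 9"
    unfolding \<rho>_def using n k(1) by (rule exp_ln_hundredth_less)
  obtain X where X: "orthogonal_family n X" and card_X: "card X < k"
    and good: "\<forall>x \<in> topspace (Euclidean_space n).
          (\<forall>v\<in>X. ip n x v = 0) \<longrightarrow> ip n x x \<le> \<rho> \<longrightarrow> x \<in> A + A"
    using exists_orthogonal_family[OF A \<rho> k(3)] by (elim exE conjE)
  (* The semi-axes are of order sqrt k along X and of order sqrt n across it, and
     the trace of Q is at most 1 / 4 + 1 / 4. *)
  define Q where "Q = (\<lambda>i j. (if i = j then 1 / (4 * real n) else 0)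
      + 1 / (4 * real k) * (\<Sum>v\<in>X. v i * v j / ip n v v))"
  define s where "s x = (\<Sum>v\<in>X. (ip n x v)\<^sup>2 / ip n v v)" for x
  have s0: "0 \<le> s x" for x
    unfolding s_def by (intro sum_nonneg divide_nonneg_nonneg ip_self_nonneg) simp
  have Q: "quad_form n Q x = 1 / (4 * real n) * ip n x x + 1 / (4 * real k) * s x" for x
    unfolding Q_def s_def by (rule quad_form_orthogonal_family)
  have psd: "sym_psd n Q"
    unfolding sym_psd_def Q using s0 ip_self_nonneg by (auto simp: Q_def mult.commute)
  have "(\<Sum>i<n. Q i i) = real n * (1 / (4 * real n)) + 1 / (4 * real k) * real (card X)"
    unfolding Q_def by (rule trace_orthogonal_family[OF X])
  also have "\<dots> \<le> 1 / 2" using n k(3) card_X by (simp add: field_simps)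
  finally have trace: "(\<Sum>i<n. Q i i) \<le> 1 / 2" .
  define E where "E = {x \<in> topspace (Euclidean_space n). quad_form n Q x \<le> 1}"
  define c where "c = sqrt (ln (real n) / real n)"
  have c2: "c\<^sup>2 = ln (real n) / real n" using n by (simp add: c_def)
  have "ln (sqrt (real n)) \<le> sqrt (real n)" using sqrt_n by (intro ln_bound) auto
  then have "ln (real n) \<le> 2 * sqrt (real n)" using n by (simp add: ln_sqrt)
  then have "ln (real n) * real k \<le> (2 * sqrt (real n)) * (2 * sqrt (real n))"
    using k sqrt_n by (intro mult_mono) auto
  also have "\<dots> = 4 * (sqrt (real n) * sqrt (real n))" by simp
  also have "\<dots> = 4 * real n" by simp
  finally have lnk: "c\<^sup>2 * (4 * real k) \<le> 16" using n by (simp add: c2 field_simps)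
  (* After the dilation, the component along X is bounded (of length at most 4) and
     the component across it has length at most 2 * sqrt (ln n). One twentieth of the
     former is in the small ball, one twentieth of the latter is in the large ball
     orthogonal to X. *)
  have "dilate c E \<subseteq> (\<Sum>k<4 * 20 :: nat. A)"
  proof
    fix y assume "y \<in> dilate c E"
    then obtain x where x: "x \<in> E" and y: "y = (\<lambda>i. c * x i)" by (auto simp: dilate_def)
    have xt: "\<And>i. i \<ge> n \<Longrightarrow> x i = 0" using x by (auto simp: E_def topspace_Euclidean_space)
    have q: "1 / (4 * real n) * ip n x x + 1 / (4 * real k) * s x \<le> 1"
      using x by (simp add: E_def Q)
    have "0 \<le> 1 / (4 * real n) * ip n x x" "0 \<le> 1 / (4 * real k) * s x"
      using s0[of x] ip_self_nonneg[of n x] by (intro mult_nonneg_nonneg; simp)+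
    then have "1 / (4 * real n) * ip n x x \<le> 1" "1 / (4 * real k) * s x \<le> 1"
      using q by linarith+
    then have bounds: "ip n x x \<le> 4 * real n" "s x \<le> 4 * real k"
      using n k(3) by (auto simp: field_simps)
    define p where "p = (\<lambda>i. \<Sum>v\<in>X. ip n x v / ip n v v * v i)"
    define w where "w = (\<lambda>i. x i - p i)"
    note decomp = orthogonal_decomposition[OF X p_def, folded w_def s_def]
    have pt: "p i = 0" if "i \<ge> n" for i
      using X that by (auto simp: p_def orthogonal_family_def topspace_Euclidean_space intro!: sum.neutral)
    have "(\<lambda>i. c / 20 * p i) \<in> A + A"
    proof (rule small_vector_in_sumset[OF A])
      have "c\<^sup>2 * s x \<le> c\<^sup>2 * (4 * real k)" using bounds by (intro mult_left_mono) auto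
      also note lnk
      finally have "ip n (\<lambda>i. c / 20 * p i) (\<lambda>i. c / 20 * p i) \<le> 4 / 100"
        unfolding ip_scale decomp(1) power_divide by (simp add: mult.commute)
      then show "exp (ip n (\<lambda>i. c / 20 * p i) (\<lambda>i. c / 20 * p i)) - 1 < 1 / 9"
        by (rule exp_minus_one_less_ninth)
    qed (auto simp: topspace_Euclidean_space pt)
    moreover have "(\<lambda>i. c / 20 * w i) \<in> A + A"
    proof (rule good[rule_format])
      have "c\<^sup>2 * ip n w w \<le> c\<^sup>2 * (4 * real n)" using bounds decomp(3) by (intro mult_left_mono) auto
      also have "\<dots> = 4 * ln (real n)" using n by (simp add: c2)
      finally show "ip n (\<lambda>i. c / 20 * w i) (\<lambda>i. c / 20 * w i) \<le> \<rho>"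
        unfolding ip_scale \<rho>_def power_divide by (simp add: mult.commute)
      show "ip n (\<lambda>i. c / 20 * w i) v = 0" if "v \<in> X" for v
      proof -
        have "ip n (\<lambda>i. c / 20 * w i) v = c / 20 * ip n w v"
          by (simp add: ip_def sum_distrib_left mult.assoc)
        then show ?thesis using decomp(2) that by simp
      qed
    qed (auto simp: topspace_Euclidean_space w_def pt xt)
    ultimately have "(\<lambda>i. c * p i / real 20) \<in> A + A" "(\<lambda>i. c * w i / real 20) \<in> A + A"
      by simp_all
    then have "(\<lambda>i. c * p i + c * w i) \<in> (\<Sum>k<4 * 20 :: nat. A)"
      by (intro add_mem_iterated_sumset[of 20] zero_less_numeral)
    moreover have "y = (\<lambda>i. c * p i + c * w i)"
      by (simp add: y w_def algebra_simps)
    ultimately show "y \<in> (\<Sum>k<4 * 20 :: nat. A)" by (simp only:)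
  qed
  moreover have "ellipsoid n E" unfolding ellipsoid_def E_def using psd by (intro exI[of _ Q] conjI refl)
  moreover have "1 / 2 \<le> measure (std_gaussian n) E"
    unfolding E_def by (rule measure_ellipsoid_ge_half[OF psd trace])
  ultimately show "\<exists>E. ellipsoid n E \<and> 1 / 2 \<le> measure (std_gaussian n) E \<and>
      dilate (sqrt (ln (real n) / real n)) E \<subseteq> (\<Sum>k<4 * 20 :: nat. A)"
    unfolding c_def by (intro exI[of _ E] conjI)
qed

end
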